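(* Let $k\ge1$ and $m\ge 0$ be integers, let $r=m \bmod P_k$, and let $$E=\bigl|\{\,i:\ 1<i\le k,\ p_i\nmid r,\ \text{and }\bigl(2\mid r-(r\bmod p_i)+p_i\ \text{ or }\ p_i\mid r-1\bigr)\}\bigr|.$$ Then $$\varphi(P_k)\left\lfloor\frac{m}{P_k}\right\rfloor+r-\sum_{i=1}^{k}\left\lceil\frac{r}{p_i}\right\rceil+\sum_{i=2}^{k}\left\lfloor\frac{r}{2p_i}\right\rfloor+E+\sum_{i=2}^{k-1}\sum_{j=i+1}^{k}\varphi_{min}\!\left(\left\lfloor\frac{r}{p_ip_j}\right\rfloor,\,i-1\right)\le\varphi_{min}(m,k).$$
   Context: $p_i$ denotes the $i$-th prime ($p_1=2$) and $P_k=p_1\cdots p_k$; $\varphi(n)$ is Euler's totient function. For integers $b$, $n\ge0$, $t\ge1$, $\varphi(b,n,t)$ is the number of integers $a$ with $b<a\le b+n$ and $\gcd(a,P_t)=1$, and $\varphi_{min}(n,t)=\min_{b\in\mathbb{Z}}\varphi(b,n,t)$ (so $\varphi_{min}(0,t)=0$). *)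

theory Defs
  imports Complex_Main "HOL-Library.Infinite_Set" "HOL-Number_Theory.Totient"
begin

text \<open>Primes are indexed from 1, while \<open>enumerate\<close> counts from 0; the value at index 0 is irrelevant.\<close>

definition nth_prime :: "nat \<Rightarrow> nat" where
  "nth_prime i = enumerate {p. prime p} (i - 1)"

definition primorial :: "nat \<Rightarrow> nat" where
  "primorial k = (\<Prod>i = 1..k. nth_prime i)"

definition phi_count :: "int \<Rightarrow> nat \<Rightarrow> nat \<Rightarrow> nat" where
  "phi_count b n t = card {a :: int. b < a \<and> a \<le> b + int n \<and> gcd a (int (primorial t)) = 1}"

lemma phi_count_le: "phi_count b n t \<le> n"
proof -
  have "phi_count b n t \<le> card {b <.. b + int n}"
    unfolding phi_count_def by (rule card_mono) auto
  then show ?thesis by simp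
qed

text \<open>The minimum ranges over all integers \<open>b\<close>, but over a finite set of values.\<close>

lemma finite_range_phi_count: "finite (range (\<lambda>b. phi_count b n t))"
  by (rule finite_subset[of _ "{..n}"]) (auto simp: phi_count_le)

definition phi_min :: "nat \<Rightarrow> nat \<Rightarrow> nat" where
  "phi_min n t = Min (range (\<lambda>b. phi_count b n t))"

lemma phi_min_0: "phi_min 0 t = 0"
  unfolding phi_min_def
  using phi_count_le[of _ 0 t] by simp

lemma nth_prime_1: "nth_prime 1 = 2"
  unfolding nth_prime_def
  by (auto simp: enumerate_0 intro!: Least_equality prime_ge_2_nat)

end

theory Submission
  imports Defs
begin

text \<open>
  By periodicity it suffices to bound the count in an interval \<open>(b, b + r]\<close>. This count is \<open>r\<close> minus the
  numbers of multiples of each \<open>p\<^sub>j\<close>, plus, for \<open>i < j\<close>, the number of multiples of \<open>p\<^sub>i p\<^sub>j\<close> coprime to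
  \<open>P\<^sub>i\<^sub>-\<^sub>1\<close>; the latter is at least \<open>\<phi>\<^sub>m\<^sub>i\<^sub>n(\<lfloor>r / p\<^sub>i p\<^sub>j\<rfloor>, i - 1)\<close>. The terms with \<open>i = 1\<close> turn multiples of \<open>p\<^sub>j\<close> into
  odd multiples, which yields the contribution of \<open>j\<close> to \<open>E\<close> unless \<open>j\<close> is exceptional: \<open>r\<close> and \<open>b + 1\<close>
  are odd and \<open>p\<^sub>j\<close> divides both \<open>r - 1\<close> and \<open>b + 1\<close>. If there are exceptional \<open>j\<close>, one unit is regained
  because the interval contains only \<open>\<lceil>r / 2\<rceil> - 1\<close> even numbers. Let \<open>p\<^sub>d\<close> be the least prime factor of
  \<open>b + 1\<close>. For every exceptional \<open>j \<noteq> d\<close> the pair \<open>(d, j)\<close> regains one more, since \<open>b + 1\<close> itself is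
  counted there and the remaining interval still has \<open>\<lfloor>r / p\<^sub>d p\<^sub>j\<rfloor>\<close> multiples of \<open>p\<^sub>d p\<^sub>j\<close>.
\<close>

section \<open>Indexed primes and coprimality to primorials\<close>

lemma prime_nth_prime: "prime (nth_prime i)"
  using enumerate_in_set[OF primes_infinite, of "i - 1"] by (simp add: nth_prime_def)

lemma nth_prime_less: "1 \<le> i \<Longrightarrow> i < j \<Longrightarrow> nth_prime i < nth_prime j"
  by (simp add: nth_prime_def enumerate_mono primes_infinite)

lemma nth_prime_eq_iff: "1 \<le> i \<Longrightarrow> 1 \<le> j \<Longrightarrow> nth_prime i = nth_prime j \<longleftrightarrow> i = j"
  by (metis less_irrefl nat_neq_iff nth_prime_less)

lemma odd_nth_prime: "1 < i \<Longrightarrow> odd (nth_prime i)"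
  using nth_prime_less[of 1 i, unfolded nth_prime_1] prime_odd_nat[OF prime_nth_prime[of i]] by simp

lemma coprime_primorial_iff:
  "gcd a (int (primorial t)) = 1 \<longleftrightarrow> (\<forall>i\<in>{1..t}. \<not> int (nth_prime i) dvd a)"
proof -
  have "gcd a (int (primorial t)) = 1 \<longleftrightarrow> coprime a (int (primorial t))"
    by (simp add: coprime_iff_gcd_eq_1)
  also have "\<dots> \<longleftrightarrow> (\<forall>i\<in>{1..t}. coprime a (int (nth_prime i)))"
  proof (induction t)
    case 0
    show ?case by (simp add: primorial_def)
  next
    case (Suc t)
    then show ?case by (auto simp: primorial_def atLeastAtMostSuc_conv)
  qed
  also have "\<dots> \<longleftrightarrow> (\<forall>i\<in>{1..t}. \<not> int (nth_prime i) dvd a)"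
  proof -
    have "coprime a (int (nth_prime i)) \<longleftrightarrow> \<not> int (nth_prime i) dvd a" for i
    proof -
      have "prime (int (nth_prime i))" by (simp add: prime_nth_prime)
      then show ?thesis
        by (metis coprime_commute coprime_absorb_left not_prime_unit prime_imp_coprime)
    qed
    then show ?thesis by simp
  qed
  finally show ?thesis .
qed

section \<open>The counting function: additivity, minimum and periodicity\<close>

lemma phi_count_add: "phi_count b (m + n) t = phi_count b m t + phi_count (b + int m) n t"
proof -
  have "{a. b < a \<and> a \<le> b + int (m + n) \<and> gcd a (int (primorial t)) = 1} =
    {a. b < a \<and> a \<le> b + int m \<and> gcd a (int (primorial t)) = 1} \<union>
    {a. b + int m < a \<and> a \<le> b + int m + int n \<and> gcd a (int (primorial t)) = 1}"
    by auto
  moreover have "finite {a. c < a \<and> a \<le> c + int l \<and> gcd a (int (primorial t)) = 1}" for c l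
    by (rule finite_subset[of _ "{c..c + int l}"]) auto
  ultimately show ?thesis
    unfolding phi_count_def by (subst card_Un_disjoint[symmetric]) auto
qed

lemma phi_count_one: "phi_count b 1 t = of_bool (gcd (b + 1) (int (primorial t)) = 1)"
proof -
  have "{a. b < a \<and> a \<le> b + int 1 \<and> gcd a (int (primorial t)) = 1} =
    {a. a = b + 1 \<and> gcd a (int (primorial t)) = 1}"
    by (rule Collect_cong) (metis add.commute add1_zle_eq antisym of_nat_1 order_refl)
  also have "\<dots> = (if gcd (b + 1) (int (primorial t)) = 1 then {b + 1} else {})"
    by auto
  finally show ?thesis
    unfolding phi_count_def by (simp only: split: if_split) simp
qed

lemma phi_count_mono: "m \<le> n \<Longrightarrow> phi_count b m t \<le> phi_count b n t"
  using phi_count_add[of b m "n - m" t] by simp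

lemma phi_min_le: "phi_min n t \<le> phi_count b n t"
  unfolding phi_min_def by (intro Min_le finite_range_phi_count) auto

lemma phi_min_attained: "\<exists>b. phi_min n t = phi_count b n t"
  using Min_in[OF finite_range_phi_count, of n t] unfolding phi_min_def by auto

text \<open>Sliding the window by one trades \<open>b + 1\<close> for
  \<open>b + 1 + primorial t\<close>, which has the same gcd with the primorial. So the count does
  not depend on \<open>b\<close>, and at \<open>b = 0\<close> it counts the totatives.\<close>

lemma phi_count_period: "phi_count b (primorial t) t = totient (primorial t)"
proof -
  let ?P = "primorial t"
  have shift: "phi_count (c + 1) ?P t = phi_count c ?P t" for c
  proof -
    have "gcd (c + int ?P + 1) (int ?P) = gcd (c + 1) (int ?P)"
      by (metis add.assoc add.commute gcd_add1)
    then have "phi_count (c + int ?P) 1 t = phi_count c 1 t"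
      by (simp only: phi_count_one)
    \<comment> \<open>The window of length \<open>?P + 1\<close> after \<open>c\<close> is cut once
      before its last element and once after its first.\<close>
    then show ?thesis
      using phi_count_add[of c ?P 1 t] phi_count_add[of c 1 ?P t] by (simp add: add.commute)
  qed
  have "phi_count b ?P t = phi_count 0 ?P t"
  proof (induction b rule: int_induct[where k = 0])
    case (step2 i)
    then show ?case using shift[of "i - 1"] by simp
  qed (simp_all add: shift)
  also have "\<dots> = totient ?P"
  proof -
    have "{a. 0 < a \<and> a \<le> 0 + int ?P \<and> gcd a (int ?P) = 1} = int ` totatives ?P"
    proof (intro equalityI subsetI)
      fix a assume "a \<in> {a. 0 < a \<and> a \<le> 0 + int ?P \<and> gcd a (int ?P) = 1}"
      moreover from this obtain c where "a = int c"
        by (auto elim: zero_less_imp_eq_int[THEN exE])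
      ultimately show "a \<in> int ` totatives ?P"
        by (auto simp: totatives_def coprime_iff_gcd_eq_1)
    qed (auto simp: totatives_def coprime_iff_gcd_eq_1)
    then show ?thesis
      by (simp add: phi_count_def totient_def card_image)
  qed
  finally show ?thesis .
qed

lemma phi_count_add_periods:
  "phi_count b (n + q * primorial t) t = phi_count b n t + q * totient (primorial t)"
proof (induction q)
  case (Suc q)
  then show ?case
    using phi_count_add[of b "n + q * primorial t" "primorial t" t]
    by (simp add: phi_count_period algebra_simps)
qed simp

section \<open>Multiples of a number and of a pair of primes in a window\<close>

lemma le_div_iff_mult_le_int: "d > 0 \<Longrightarrow> x \<le> y div d \<longleftrightarrow> x * d \<le> (y :: int)"
proof
  assume d: "d > 0"
  show "x * d \<le> y" if "x \<le> y div d"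
  proof -
    have "x * d \<le> y div d * d" using that d by (intro mult_right_mono) auto
    also have "\<dots> \<le> y" using d by (simp add: minus_mod_eq_div_mult[symmetric])
    finally show ?thesis .
  qed
  show "x \<le> y div d" if "x * d \<le> y"
    using zdiv_mono1[OF that d] d by simp
qed

lemma div_less_iff_less_mult_int: "d > 0 \<Longrightarrow> y div d < x \<longleftrightarrow> (y :: int) < x * d"
  using le_div_iff_mult_le_int[of d x y] by linarith

lemma card_multiples:
  fixes b d :: int
  assumes "d > 0"
  shows "int (card {a. b < a \<and> a \<le> b + int n \<and> d dvd a}) = (b + int n) div d - b div d"
proof -
  have "{a. b < a \<and> a \<le> b + int n \<and> d dvd a} = (\<lambda>x. d * x) ` {b div d<..(b + int n) div d}"
    using assms by (auto simp: image_iff div_less_iff_less_mult_int le_div_iff_mult_le_int mult.commute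
        elim!: dvdE)
  moreover have "inj_on (\<lambda>x. d * x) {b div d<..(b + int n) div d}"
    using assms by (auto simp: inj_on_def)
  ultimately show ?thesis
    using assms by (simp add: card_image zdiv_mono1)
qed

text \<open>The gcd condition makes \<open>nth_prime i\<close> the least prime factor of
  \<open>a\<close>, so for fixed \<open>j\<close> distinct \<open>i < j\<close> count disjoint sets.
  For \<open>i = 1\<close> it is vacuous.\<close>

definition pair_count :: "int \<Rightarrow> nat \<Rightarrow> nat \<Rightarrow> nat \<Rightarrow> nat" where
  "pair_count b n i j = card {a. b < a \<and> a \<le> b + int n \<and> int (nth_prime i) dvd a \<and>
     int (nth_prime j) dvd a \<and> gcd a (int (primorial (i - 1))) = 1}"

lemma int_primes_mult_dvd_iff:
  assumes "1 \<le> i" "i < j"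
  shows "int (nth_prime i) * int (nth_prime j) dvd a \<longleftrightarrow>
    int (nth_prime i) dvd a \<and> int (nth_prime j) dvd a"
proof -
  have "coprime (nth_prime i) (nth_prime j)"
    using assms nth_prime_less[OF assms] by (intro primes_coprime prime_nth_prime) auto
  then have "coprime (int (nth_prime i)) (int (nth_prime j))"
    by simp
  then show ?thesis
    by (metis divides_mult dvd_mult_left dvd_mult_right)
qed

text \<open>Division by \<open>d\<close> maps the multiples of \<open>d\<close> onto a window of
  quotients. Neither factor of \<open>d\<close> is among the first \<open>i - 1\<close> primes, so
  coprimality to their product is unaffected.\<close>

lemma pair_count_eq_phi_count:
  fixes b :: int
  assumes "1 \<le> i" "i < j"
  defines "d \<equiv> int (nth_prime i) * int (nth_prime j)"
  shows "pair_count b n i j = phi_count (b div d) (nat ((b + int n) div d - b div d)) (i - 1)"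
proof -
  have d: "d > 0"
    by (simp add: d_def prime_gt_0_nat prime_nth_prime)
  have *: "gcd (d * x) (int (primorial (i - 1))) = 1 \<longleftrightarrow> gcd x (int (primorial (i - 1))) = 1" for x
  proof -
    have "int (nth_prime l) dvd d * x \<longleftrightarrow> int (nth_prime l) dvd x" if "l \<in> {1..i - 1}" for l
    proof -
      have "nth_prime l \<noteq> nth_prime i" "nth_prime l \<noteq> nth_prime j"
        using that assms by (auto simp: nth_prime_eq_iff)
      then have "\<not> int (nth_prime l) dvd int (nth_prime i)" "\<not> int (nth_prime l) dvd int (nth_prime j)"
        by (auto simp: prime_nth_prime primes_dvd_imp_eq)
      then show ?thesis
        by (simp add: d_def prime_dvd_mult_iff prime_nth_prime)
    qed
    then show ?thesis
      by (auto simp: coprime_primorial_iff)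
  qed
  have le: "b div d \<le> (b + int n) div d"
    using d by (simp add: zdiv_mono1)
  have "{a. b < a \<and> a \<le> b + int n \<and> int (nth_prime i) dvd a \<and> int (nth_prime j) dvd a \<and>
       gcd a (int (primorial (i - 1))) = 1} =
    (\<lambda>x. d * x) ` {x. b div d < x \<and> x \<le> b div d + int (nat ((b + int n) div d - b div d)) \<and>
       gcd x (int (primorial (i - 1))) = 1}" (is "?L = ?R")
  proof -
    have "?L = {a. b < a \<and> a \<le> b + int n \<and> d dvd a \<and> gcd a (int (primorial (i - 1))) = 1}"
      using int_primes_mult_dvd_iff[OF assms(1,2)] by (auto simp: d_def)
    also have "\<dots> = (\<lambda>x. d * x) ` {x. b < x * d \<and> x * d \<le> b + int n \<and>
        gcd (d * x) (int (primorial (i - 1))) = 1}"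
      by (auto simp: image_iff mult.commute elim!: dvdE)
    also have "\<dots> = ?R"
      using d le unfolding * by (simp add: div_less_iff_less_mult_int le_div_iff_mult_le_int)
    finally show ?thesis .
  qed
  moreover have "inj_on (\<lambda>x. d * x) A" for A
    using d by (auto simp: inj_on_def)
  ultimately show ?thesis
    by (simp add: pair_count_def phi_count_def card_image)
qed

lemma div_add_le: "d > 0 \<Longrightarrow> b div d + n div d \<le> (b + n) div (d :: int)"
  by (subst div_add1_eq) (simp add: pos_imp_zdiv_nonneg_iff)

text \<open>Wherever the window starts, its quotients by \<open>d\<close> form a window of length at
  least \<open>n div d\<close>.\<close>

lemma phi_min_le_pair_count:
  assumes "1 \<le> i" "i < j"
  shows "phi_min (n div (nth_prime i * nth_prime j)) (i - 1) \<le> pair_count b n i j"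
proof -
  define d where "d = int (nth_prime i) * int (nth_prime j)"
  have "d > 0"
    by (simp add: d_def prime_gt_0_nat prime_nth_prime)
  then have "n div (nth_prime i * nth_prime j) \<le> nat ((b + int n) div d - b div d)"
    using div_add_le[of d b "int n"] zdiv_int[of n "nth_prime i * nth_prime j"] by (simp add: d_def)
  from phi_count_mono[OF this, of "b div d" "i - 1"] show ?thesis
    unfolding pair_count_eq_phi_count[OF assms] d_def using phi_min_le le_trans by blast
qed

text \<open>The first element \<open>b + 1 = d * x\<close> is itself counted, and the
  \<open>q\<close> quotients following \<open>x\<close> still fit into the window, so they
  contribute the minimum on top of it.\<close>

lemma phi_min_less_pair_count:
  assumes "1 \<le> i" "i < j"
    and "int (nth_prime i) dvd b + 1" "int (nth_prime j) dvd b + 1"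
    and "\<not> nth_prime j dvd n"
    and least: "gcd (b + 1) (int (primorial (i - 1))) = 1"
  shows "phi_min (n div (nth_prime i * nth_prime j)) (i - 1) < pair_count b n i j"
proof -
  define d where "d = int (nth_prime i) * int (nth_prime j)"
  have d: "d > 1"
    using prime_gt_1_nat[OF prime_nth_prime[of i]] prime_gt_1_nat[OF prime_nth_prime[of j]]
    by (simp add: d_def less_1_mult)
  define q where "q = n div (nth_prime i * nth_prime j)"
  have "d dvd b + 1"
    unfolding d_def using assms by (simp add: int_primes_mult_dvd_iff)
  then obtain x where x: "b + 1 = d * x" by blast
  have b: "b div d = x - 1"
  proof -
    have "b = d * (x - 1) + (d - 1)"
      using x by (simp add: algebra_simps)
    then show ?thesis
      by (rule int_div_pos_eq) (use d in auto)
  qed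
  have n: "int n = d * int q + int (n mod (nth_prime i * nth_prime j))"
    unfolding q_def d_def by (metis mult_div_mod_eq of_nat_add of_nat_mult)
  \<comment> \<open>The last element is \<open>d * (x + q) - 1\<close> plus this remainder; being
    nonzero, it makes up for the missing unit.\<close>
  have "n mod (nth_prime i * nth_prime j) > 0"
    using assms(5) by (metis dvd_mult_right gr0I mod_0_imp_dvd)
  then have "d * (x + int q) \<le> b + int n"
    using x n by (simp add: algebra_simps)
  then have "x + int q \<le> (b + int n) div d"
    using d by (simp add: le_div_iff_mult_le_int mult.commute)
  then have len: "1 + q \<le> nat ((b + int n) div d - b div d)"
    using b by simp
  have "gcd x (int (primorial (i - 1))) = 1"
    using least x by (auto simp: coprime_primorial_iff)
  then have "phi_count (b div d) (1 + q) (i - 1) = 1 + phi_count x q (i - 1)"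
    unfolding phi_count_add phi_count_one b by simp
  moreover have "phi_min q (i - 1) \<le> phi_count x q (i - 1)"
    by (rule phi_min_le)
  ultimately show ?thesis
    unfolding pair_count_eq_phi_count[OF assms(1,2)]
    using phi_count_mono[OF len, of "b div d" "i - 1"] by (simp add: d_def q_def)
qed

section \<open>The sieve identity and the count of odd multiples\<close>

text \<open>Legendre's sieve stopped after two steps: an element divisible by \<open>p\<^sub>j\<close> and by a smaller prime
  is classified by its least prime factor \<open>p\<^sub>i\<close>.\<close>

lemma phi_count_sieve:
  "int (phi_count b n k) = int n
     - (\<Sum>j = 1..k. int (card {a. b < a \<and> a \<le> b + int n \<and> int (nth_prime j) dvd a}))
     + (\<Sum>j = 1..k. \<Sum>i\<in>{1..<j}. int (pair_count b n i j))"
proof (induction k)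
  case 0
  have "{a. b < a \<and> a \<le> b + int n} = {b<..b + int n}" by auto
  then show ?case by (simp add: phi_count_def primorial_def)
next
  case (Suc k)
  define S where "S = {b<..b + int n}"
  have fin: "finite S" by (simp add: S_def)
  define D where "D i a \<longleftrightarrow> int (nth_prime i) dvd a" for i a
  define A where "A k = {a\<in>S. \<forall>i\<in>{1..k}. \<not> D i a}" for k
  define B where "B i = {a\<in>S. D i a \<and> D (Suc k) a \<and> (\<forall>l\<in>{1..i - 1}. \<not> D l a)}" for i
  have A: "phi_count b n t = card (A t)" for t
    unfolding phi_count_def A_def S_def D_def coprime_primorial_iff
    by (rule arg_cong[of _ _ card]) auto
  have B: "pair_count b n i (Suc k) = card (B i)" for i
    unfolding pair_count_def B_def S_def D_def coprime_primorial_iff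
    by (rule arg_cong[of _ _ card]) auto
  have N: "{a. b < a \<and> a \<le> b + int n \<and> int (nth_prime (Suc k)) dvd a} = {a\<in>S. D (Suc k) a}"
    by (auto simp: S_def D_def)
  have "A k = A (Suc k) \<union> (A k \<inter> {a. D (Suc k) a})"
    by (auto simp: A_def atLeastAtMostSuc_conv)
  moreover have "A (Suc k) \<inter> (A k \<inter> {a. D (Suc k) a}) = {}"
    by (auto simp: A_def)
  ultimately have 1: "card (A k) = card (A (Suc k)) + card (A k \<inter> {a. D (Suc k) a})"
    using card_Un_disjoint[of "A (Suc k)" "A k \<inter> {a. D (Suc k) a}"] fin by (simp add: A_def)
  \<comment> \<open>Multiples of the new prime either have survived so far, and are what this
    sieving step removes, or had been removed before; the latter are sorted by the index of their
    least prime factor.\<close>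
  have "{a\<in>S. D (Suc k) a} = (A k \<inter> {a. D (Suc k) a}) \<union> (\<Union>i\<in>{1..k}. B i)"
  proof (intro equalityI subsetI)
    fix a assume a: "a \<in> {a\<in>S. D (Suc k) a}"
    show "a \<in> (A k \<inter> {a. D (Suc k) a}) \<union> (\<Union>i\<in>{1..k}. B i)"
    proof (cases "a \<in> A k")
      case False
      define i where "i = (LEAST i. 1 \<le> i \<and> D i a)"
      from False a obtain i' where i': "1 \<le> i' \<and> D i' a" "i' \<le> k" by (auto simp: A_def)
      have "1 \<le> i \<and> D i a" unfolding i_def using i'(1) by (rule LeastI)
      moreover have "i \<le> k" using Least_le[of "\<lambda>i. 1 \<le> i \<and> D i a", OF i'(1)] i'(2) by (simp add: i_def)
      moreover have "\<not> D l a" if "l \<in> {1..i - 1}" for l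
      proof -
        have "l < i" using that \<open>1 \<le> i \<and> D i a\<close> by auto
        then show ?thesis
          using that not_less_Least[of l "\<lambda>i. 1 \<le> i \<and> D i a"] by (simp add: i_def)
      qed
      ultimately show ?thesis using a by (auto simp: B_def)
    qed (use a in auto)
  qed (auto simp: A_def B_def)
  moreover have "(A k \<inter> {a. D (Suc k) a}) \<inter> (\<Union>i\<in>{1..k}. B i) = {}"
    by (auto simp: A_def B_def)
  moreover have "card (\<Union>i\<in>{1..k}. B i) = (\<Sum>i\<in>{1..k}. card (B i))"
  proof (rule card_UN_disjoint)
    have "B i \<inter> B j = {}" if "i \<in> {1..k}" "j \<in> {1..k}" "i < j" for i j
      using that by (auto simp: B_def)
    then show "\<forall>i\<in>{1..k}. \<forall>j\<in>{1..k}. i \<noteq> j \<longrightarrow> B i \<inter> B j = {}"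
      by (metis inf_commute nat_neq_iff)
  qed (use fin in \<open>auto simp: B_def\<close>)
  ultimately have 2: "card {a\<in>S. D (Suc k) a} =
      card (A k \<inter> {a. D (Suc k) a}) + (\<Sum>i\<in>{1..k}. card (B i))"
    using card_Un_disjoint[of "A k \<inter> {a. D (Suc k) a}" "\<Union>i\<in>{1..k}. B i"] fin
    by (simp add: A_def B_def)
  have "{1..<Suc k} = {1..k}" by auto
  then show ?case
    using Suc.IH 1 2 by (simp add: N A B)
qed

text \<open>The left-hand side counts the odd multiples of \<open>p\<close> in an interval of length \<open>r\<close>. The bound
  fails to improve by one for \<open>p\<close> counted in \<open>E\<close> only if the interval begins and ends with an odd
  multiple of \<open>p\<close>.\<close>

lemma odd_multiples_le:
  fixes p b r :: int
  assumes "odd p" "p > 1" "r \<ge> 0"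
  shows "((b + r) div p - b div p) - ((b + r) div (2 * p) - b div (2 * p))
    \<le> - (- r div p) - r div (2 * p)
      - of_bool (\<not> p dvd r \<and> (2 dvd r - r mod p + p \<or> p dvd r - 1))
      + of_bool (odd r \<and> even b \<and> p dvd r - 1 \<and> p dvd b + 1)"
proof -
  define u s c t where "u = b div p" "s = b mod p" "c = r div p" "t = r mod p"
  have b: "b = p * u + s" and r: "r = p * c + t"
    by (simp_all add: u_s_c_t_def)
  have st: "0 \<le> s" "s < p" "0 \<le> t" "t < p"
    using assms by (auto simp: u_s_c_t_def)
  \<comment> \<open>The carry in adding the remainders of \<open>b\<close> and \<open>r\<close>.
    Since division by \<open>2 * p\<close> halves the quotient by \<open>p\<close>, only it, the
    parities of \<open>u\<close> and \<open>c\<close>, and the value of \<open>t\<close> matter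
    below.\<close>
  define \<delta> :: int where "\<delta> = of_bool (s + t \<ge> p)"
  have br: "(b + r) div p = u + c + \<delta>"
    by (rule int_div_pos_eq[where r = "s + t - p * \<delta>"])
      (use b r st in \<open>auto simp: \<delta>_def algebra_simps\<close>)
  have half: "x div (2 * p) = x div p div 2" for x
    using zdiv_zmult2_eq[of 2 x p] by (simp add: mult.commute)
  have ceil: "- (- r div p) = c + of_bool (t \<noteq> 0)"
  proof -
    have "- r div p = - c - of_bool (t \<noteq> 0)"
      by (rule int_div_pos_eq[where r = "of_bool (t \<noteq> 0) * p - t"])
        (use r st in \<open>auto simp: algebra_simps\<close>)
    then show ?thesis by simp
  qed
  have dvd_r: "p dvd r \<longleftrightarrow> t = 0"
    by (simp add: u_s_c_t_def dvd_eq_mod_eq_0)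
  have dvd_r1: "p dvd r - 1 \<longleftrightarrow> t = 1"
  proof -
    have "p dvd r - 1 \<longleftrightarrow> r mod p = 1 mod p"
      by (simp add: mod_eq_dvd_iff)
    then show ?thesis using assms by (simp add: u_s_c_t_def)
  qed
  have dvd_b1: "p dvd b + 1" if "s = p - 1"
  proof -
    have "b + 1 = p * (u + 1)" using b that by (simp add: algebra_simps)
    then show ?thesis by simp
  qed
  \<comment> \<open>The left side is \<open>p * (c + 1)\<close> with \<open>p\<close> odd.\<close>
  have par: "even (r - r mod p + p) \<longleftrightarrow> odd c"
  proof -
    have "r - r mod p = p * c" by (simp add: u_s_c_t_def minus_mod_eq_mult_div)
    then show ?thesis using assms(1) by simp
  qed
  have core: "c + \<delta> - ((u + c + \<delta>) div 2 - u div 2)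
    \<le> c + of_bool (t \<noteq> 0) - c div 2 - of_bool (t \<noteq> 0 \<and> (odd c \<or> t = 1))
      + of_bool (odd r \<and> even b \<and> t = 1 \<and> p dvd b + 1)"
  \<comment> \<open>The one case where the bound without correction fails. A carry with
    \<open>t = 1\<close> forces \<open>s = p - 1\<close>, so \<open>b + 1 = p * (u + 1)\<close> and
    \<open>b + r = p * (u + c + 1)\<close> are both odd multiples of \<open>p\<close>.\<close>
  proof (cases "t = 1 \<and> even c \<and> even u \<and> \<delta> = 1")
    case True
    then have "s = p - 1" using st by (auto simp: \<delta>_def split: if_splits)
    with True b r assms(1) dvd_b1 have "odd r" "even b" "p dvd b + 1" by auto
    then show ?thesis using True by auto
  next
    case False
    have "\<delta> = 0 \<or> \<delta> = 1 \<and> t \<noteq> 0" using st by (auto simp: \<delta>_def)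
    moreover have "(0::int) \<le> of_bool (odd r \<and> even b \<and> t = 1 \<and> p dvd b + 1)" by simp
    moreover have "c + \<delta> - ((u + c + \<delta>) div 2 - u div 2)
      \<le> c + of_bool (t \<noteq> 0) - c div 2 - of_bool (t \<noteq> 0 \<and> (odd c \<or> t = 1))"
      if "\<delta> = 0 \<or> \<delta> = 1 \<and> t \<noteq> 0"
      using that False by (cases "t = 0"; cases "t = 1"; cases "odd c"; simp) presburger+
    ultimately show ?thesis by linarith
  qed
  have "u + c + \<delta> - u = c + \<delta>" "b div p = u" "r div p = c"
    by (simp_all add: u_s_c_t_def)
  then show ?thesis
    using core unfolding half br ceil dvd_r dvd_r1 par by simp
qed

section \<open>Pairs containing the prime 2 and pairs of odd primes\<close>

text \<open>Pairs with \<open>i = 1\<close> are counted exactly, to pass from multiples to odd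
  multiples; only the others are bounded by \<open>phi_min\<close>.\<close>

lemma sum_pairs_split_first:
  fixes f :: "nat \<Rightarrow> nat \<Rightarrow> 'a :: comm_monoid_add"
  shows "(\<Sum>j = 1..k. \<Sum>i\<in>{1..<j}. f i j) =
    (\<Sum>j = 2..k. f 1 j) + (\<Sum>i = 2..k - 1. \<Sum>j = i + 1..k. f i j)"
proof -
  have "(\<Sum>j = 1..k. \<Sum>i\<in>{1..<j}. f i j) = (\<Sum>j = 2..k. \<Sum>i\<in>{1..<j}. f i j)"
    by (rule sum.mono_neutral_right) auto
  also have "\<dots> = (\<Sum>j = 2..k. f 1 j + (\<Sum>i\<in>{i\<in>{2..k - 1}. i < j}. f i j))"
  proof (rule sum.cong[OF refl])
    fix j assume "j \<in> {2..k}"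
    then have "{1..<j} = insert 1 {i\<in>{2..k - 1}. i < j}" by auto
    then show "(\<Sum>i\<in>{1..<j}. f i j) = f 1 j + (\<Sum>i\<in>{i\<in>{2..k - 1}. i < j}. f i j)" by simp
  qed
  also have "\<dots> = (\<Sum>j = 2..k. f 1 j) + (\<Sum>i = 2..k - 1. \<Sum>j\<in>{j\<in>{2..k}. i < j}. f i j)"
    unfolding sum.distrib by (subst sum.swap_restrict) auto
  also have "(\<Sum>i = 2..k - 1. \<Sum>j\<in>{j\<in>{2..k}. i < j}. f i j) = (\<Sum>i = 2..k - 1. \<Sum>j = i + 1..k. f i j)"
    by (intro sum.cong) auto
  finally show ?thesis .
qed

lemma pair_count_first:
  assumes "1 < j"
  shows "int (pair_count b n 1 j) =
    (b + int n) div (2 * int (nth_prime j)) - b div (2 * int (nth_prime j))"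
proof -
  have "phi_count c l 0 = l" for c l
  proof -
    have "{a. c < a \<and> a \<le> c + int l} = {c<..c + int l}" by auto
    then show ?thesis by (simp add: phi_count_def primorial_def)
  qed
  moreover have "0 < nth_prime j" by (simp add: prime_gt_0_nat prime_nth_prime)
  ultimately show ?thesis
    using assms nth_prime_1 by (simp add: pair_count_eq_phi_count zdiv_mono1)
qed

text \<open>With \<open>nth_prime d\<close> the least prime factor of \<open>b + 1\<close>, each
  \<open>j\<close> in \<open>J\<close> other than \<open>d\<close> gains one in the pair
  \<open>(d, j)\<close>. Only \<open>d\<close> itself may lack such a pair, whence the
  \<open>- 1\<close>.\<close>

lemma phi_min_sum_add_exceptional_le:
  fixes b :: int
  assumes "even b" and J: "J \<subseteq> {2..k}" "J \<noteq> {}"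
    and b: "\<And>j. j \<in> J \<Longrightarrow> int (nth_prime j) dvd b + 1"
    and r: "\<And>j. j \<in> J \<Longrightarrow> \<not> nth_prime j dvd r"
  shows "(\<Sum>i = 2..k - 1. \<Sum>j = i + 1..k. int (phi_min (r div (nth_prime i * nth_prime j)) (i - 1)))
      + int (card J) - 1
    \<le> (\<Sum>i = 2..k - 1. \<Sum>j = i + 1..k. int (pair_count b r i j))"
proof -
  define Q where "Q i \<longleftrightarrow> 1 \<le> i \<and> int (nth_prime i) dvd b + 1" for i
  define d where "d = (LEAST i. Q i)"
  have QJ: "Q j" if "j \<in> J" for j
    using that J b by (auto simp: Q_def)
  then have Qd: "Q d"
    unfolding d_def using J(2) by (metis LeastI all_not_in_conv)
  have dle: "d \<le> j" if "j \<in> J" for j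
    unfolding d_def using QJ[OF that] by (rule Least_le)
  \<comment> \<open>As \<open>b + 1\<close> is odd, \<open>d\<close> is at least 2, the first index
    of the sum over pairs.\<close>
  have "\<not> Q 1"
    using assms(1) nth_prime_1 by (simp add: Q_def)
  with Qd have d2: "2 \<le> d"
    by (metis Q_def One_nat_def Suc_1 le_antisym not_less_eq_eq)
  have cop: "gcd (b + 1) (int (primorial (d - 1))) = 1"
    unfolding coprime_primorial_iff
  proof
    fix i assume "i \<in> {1..d - 1}"
    then have "i < d" "1 \<le> i"
      using d2 by auto
    then have "\<not> Q i"
      using not_less_Least[of i Q] by (simp add: d_def)
    with \<open>1 \<le> i\<close> show "\<not> int (nth_prime i) dvd b + 1" by (simp add: Q_def)
  qed
  have termwise: "int (phi_min (r div (nth_prime i * nth_prime j)) (i - 1)) + of_bool (i = d \<and> j \<in> J)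
      \<le> int (pair_count b r i j)" if "2 \<le> i" "i < j" for i j
  proof (cases "i = d \<and> j \<in> J")
    case True
    then show ?thesis
      using phi_min_less_pair_count[of i j b r] that Qd b r cop by (auto simp: Q_def)
  next
    case False
    then show ?thesis
      using phi_min_le_pair_count[of i j r b] that by auto
  qed
  have "int (card J) - 1 \<le> (\<Sum>i = 2..k - 1. \<Sum>j = i + 1..k. of_bool (i = d \<and> j \<in> J))"
  proof (cases "d \<in> {2..k - 1}")
    case True
    have "J - {d} \<subseteq> {j\<in>{d + 1..k}. j \<in> J}"
      using J dle by force
    then have "card (J - {d}) \<le> card {j\<in>{d + 1..k}. j \<in> J}"
      by (intro card_mono) auto
    moreover have "card J - 1 \<le> card (J - {d})"
      by (simp add: card_Diff_singleton_if)
    moreover have "(\<Sum>i = 2..k - 1. \<Sum>j = i + 1..k. of_bool (i = d \<and> j \<in> J)) =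
        (\<Sum>i = 2..k - 1. if i = d then \<Sum>j = d + 1..k. of_bool (j \<in> J) else (0 :: int))"
      by (intro sum.cong) auto
    moreover have "\<dots> = int (card {j\<in>{d + 1..k}. j \<in> J})"
      using True by (simp add: Int_def)
    ultimately show ?thesis by linarith
  next
    case False
    \<comment> \<open>Here \<open>d\<close> is at least \<open>k\<close> and at most every element
      of \<open>J\<close>, so at most one unit is claimed and the \<open>- 1\<close> absorbs
      it.\<close>
    have "J \<subseteq> {k}" using J dle d2 False by force
    then have "card J \<le> 1" using card_mono[of "{k}" J] by simp
    moreover have "(0 :: int) \<le> (\<Sum>i = 2..k - 1. \<Sum>j = i + 1..k. of_bool (i = d \<and> j \<in> J))"
      by (intro sum_nonneg) auto
    ultimately show ?thesis by linarith
  qed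
  also have "\<dots> \<le> (\<Sum>i = 2..k - 1. \<Sum>j = i + 1..k. int (pair_count b r i j)
      - int (phi_min (r div (nth_prime i * nth_prime j)) (i - 1)))"
    by (intro sum_mono) (use termwise in \<open>force simp: algebra_simps\<close>)
  finally show ?thesis
    by (simp add: sum_subtractf)
qed

section \<open>Assembly of the bound and reduction to the remainder\<close>

lemma phi_count_lower_bound:
  fixes b :: int
  assumes "k \<ge> 1"
    and E: "E = card {i. 1 < i \<and> i \<le> k \<and> \<not> nth_prime i dvd r \<and>
               (2 dvd int r - int (r mod nth_prime i) + int (nth_prime i)
                \<or> int (nth_prime i) dvd int r - 1)}"
  shows "int r - (\<Sum>i = 1..k. - (- int r div int (nth_prime i)))
      + (\<Sum>i = 2..k. int r div (2 * int (nth_prime i))) + int E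
      + (\<Sum>i = 2..k - 1. \<Sum>j = i + 1..k. int (phi_min (r div (nth_prime i * nth_prime j)) (i - 1)))
    \<le> int (phi_count b r k)"
proof -
  define N where "N j = (b + int r) div int (nth_prime j) - b div int (nth_prime j)" for j
  define M where "M j = (b + int r) div (2 * int (nth_prime j)) - b div (2 * int (nth_prime j))" for j
  define C where "C j = - (- int r div int (nth_prime j))" for j
  define F where "F j = int r div (2 * int (nth_prime j))" for j
  define inE where "inE i \<longleftrightarrow> \<not> nth_prime i dvd r \<and>
     (2 dvd int r - int (r mod nth_prime i) + int (nth_prime i) \<or> int (nth_prime i) dvd int r - 1)" for i
  define J where "J = {j\<in>{2..k}. odd r \<and> even b \<and> int (nth_prime j) dvd int r - 1 \<and> int (nth_prime j) dvd b + 1}"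
  define X where "X = (\<Sum>i = 2..k - 1. \<Sum>j = i + 1..k. int (phi_min (r div (nth_prime i * nth_prime j)) (i - 1)))"
  define Y where "Y = (\<Sum>i = 2..k - 1. \<Sum>j = i + 1..k. int (pair_count b r i j))"
  have pos: "0 < nth_prime j" for j by (simp add: prime_gt_0_nat prime_nth_prime)
  \<comment> \<open>The prime 2 is set apart: the bound on odd multiples requires an odd
    prime.\<close>
  have split: "(\<Sum>j = 1..k. g j) = g 1 + (\<Sum>j = 2..k. g j)" for g :: "nat \<Rightarrow> int"
    using assms(1) by (simp add: sum.atLeast_Suc_atMost numeral_2_eq_2)
  have "int (phi_count b r k) = int r - (\<Sum>j = 1..k. N j) + ((\<Sum>j = 2..k. int (pair_count b r 1 j)) + Y)"
    unfolding phi_count_sieve sum_pairs_split_first Y_def using pos by (simp add: card_multiples N_def)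
  also have "(\<Sum>j = 2..k. int (pair_count b r 1 j)) = (\<Sum>j = 2..k. M j)"
    by (intro sum.cong refl) (simp add: pair_count_first[simplified] M_def)
  finally have count: "int (phi_count b r k) = int r - N 1 - (\<Sum>j = 2..k. N j) + (\<Sum>j = 2..k. M j) + Y"
    unfolding split by simp
  have "(\<Sum>j = 2..k. N j - M j) \<le> (\<Sum>j = 2..k. C j - F j - of_bool (inE j) + of_bool (j \<in> J))"
  proof (rule sum_mono)
    fix j assume j: "j \<in> {2..k}"
    show "N j - M j \<le> C j - F j - of_bool (inE j) + of_bool (j \<in> J)"
      using odd_multiples_le[of "int (nth_prime j)" "int r" b] j odd_nth_prime[of j]
        prime_gt_1_nat[OF prime_nth_prime[of j]]
      by (simp add: N_def M_def C_def F_def inE_def J_def zmod_int)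
  qed
  moreover have "(\<Sum>j = 2..k. of_bool (inE j)) = int E"
  proof -
    have "{i. 1 < i \<and> i \<le> k \<and> inE i} = {2..k} \<inter> {i. inE i}" by auto
    then show ?thesis unfolding E inE_def[symmetric] by simp
  qed
  moreover have "(\<Sum>j = 2..k. of_bool (j \<in> J)) = int (card J)"
  proof -
    have "J = {2..k} \<inter> J" by (auto simp: J_def)
    then show ?thesis by simp
  qed
  ultimately have odd: "(\<Sum>j = 2..k. N j) - (\<Sum>j = 2..k. M j)
      \<le> (\<Sum>j = 2..k. C j) - (\<Sum>j = 2..k. F j) - int E + int (card J)"
    by (simp add: sum.distrib sum_subtractf)
  \<comment> \<open>The loss of \<open>card J\<close> from the exceptional indices is repaid here:
    \<open>card J - 1\<close> by the pairs, and one by the prime 2, because a window of odd length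
    starting with an odd number has one even number fewer than \<open>C 1\<close>.\<close>
  have "N 1 + X + int (card J) \<le> C 1 + Y"
  proof (cases "J = {}")
    case True
    have "N 1 \<le> C 1"
      unfolding N_def C_def nth_prime_1 of_nat_numeral by presburger
    moreover have "X \<le> Y"
      unfolding X_def Y_def by (intro sum_mono) (simp add: phi_min_le_pair_count[simplified])
    ultimately show ?thesis using True by simp
  next
    case False
    then have "odd (int r)" "even b" by (auto simp: J_def)
    then have "N 1 = C 1 - 1"
      unfolding N_def C_def nth_prime_1 of_nat_numeral by presburger
    moreover have "\<not> nth_prime j dvd r" if "j \<in> J" for j
    proof
      assume "nth_prime j dvd r"
      then have "int (nth_prime j) dvd int r - (int r - 1)"
        using that by (intro dvd_diff[of _ "int r" "int r - 1"]) (simp_all only: J_def mem_Collect_eq int_dvd_int_iff)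
      then show False
        using prime_gt_1_nat[OF prime_nth_prime[of j]] by simp
    qed
    then have "X + int (card J) - 1 \<le> Y"
      unfolding X_def Y_def using False \<open>even b\<close>
      by (intro phi_min_sum_add_exceptional_le) (auto simp: J_def)
    ultimately show ?thesis by simp
  qed
  then show ?thesis
    using count odd unfolding C_def[symmetric] F_def[symmetric] X_def[symmetric] split by simp
qed

theorem theorem4p4:
  fixes k m r E :: nat
  assumes "k \<ge> 1"
    and "r = m mod primorial k"
    and "E = card {i. 1 < i \<and> i \<le> k \<and> \<not> nth_prime i dvd r \<and>
               (2 dvd int r - int (r mod nth_prime i) + int (nth_prime i)
                \<or> int (nth_prime i) dvd int r - 1)}"
  shows "int (totient (primorial k)) * \<lfloor>real m / real (primorial k)\<rfloor> + int r
           - (\<Sum>i = 1..k. \<lceil>real r / real (nth_prime i)\<rceil>)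
           + (\<Sum>i = 2..k. \<lfloor>real r / (2 * real (nth_prime i))\<rfloor>)
           + int E
           + (\<Sum>i = 2..k - 1. \<Sum>j = i + 1..k.
                int (phi_min (nat \<lfloor>real r / (real (nth_prime i) * real (nth_prime j))\<rfloor>) (i - 1)))
         \<le> int (phi_min m k)"
proof -
  obtain b where b: "phi_min m k = phi_count b m k"
    using phi_min_attained by blast
  \<comment> \<open>Each of the \<open>m div primorial k\<close> full periods contributes the
    totient from any start, so it remains to bound the count of length \<open>r\<close> at the
    minimizing \<open>b\<close>.\<close>
  have "m = r + m div primorial k * primorial k"
    using assms(2) by simp
  then have "phi_min m k = phi_count b r k + m div primorial k * totient (primorial k)"
    unfolding b using phi_count_add_periods by metis
  moreover have "\<lfloor>real m / real (primorial k)\<rfloor> = int (m div primorial k)"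
    by (rule floor_divide_of_nat_eq)
  moreover have "\<lceil>real r / real (nth_prime i)\<rceil> = - (- int r div int (nth_prime i))" for i
    using ceiling_divide_eq_div[of "int r" "int (nth_prime i)"] by simp
  moreover have "\<lfloor>real r / (2 * real (nth_prime i))\<rfloor> = int r div (2 * int (nth_prime i))" for i
    using floor_divide_of_nat_eq[of r "2 * nth_prime i", where 'a = real] by (simp add: zdiv_int)
  moreover have "nat \<lfloor>real r / (real (nth_prime i) * real (nth_prime j))\<rfloor> =
      r div (nth_prime i * nth_prime j)" for i j
    using floor_divide_of_nat_eq[of r "nth_prime i * nth_prime j", where 'a = real] by simp
  ultimately show ?thesis
    using phi_count_lower_bound[OF assms(1,3), of b] by (simp add: mult.commute)
qed

end
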